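(* Let $Q,Q_1,Q_2\in\mathbb{C}[x_1,\ldots,x_n]$ be homogeneous quadratic polynomials such that whenever $Q_1$ and $Q_2$ vanish then also $Q$ vanishes (i.e. for every $p\in\mathbb{C}^n$ with $Q_1(p)=Q_2(p)=0$ we have $Q(p)=0$; equivalently $Q\in\sqrt{(Q_1,Q_2)}$). Then one of the following cases holds: (1) $Q$ is in the linear span of $Q_1,Q_2$ over $\mathbb{C}$; (2) there exists a nontrivial linear combination of the form $\alpha Q_1+\beta Q_2=\ell^2$, where $\alpha,\beta\in\mathbb{C}$ are not both zero and $\ell$ is a linear function; (3) there exist two linear functions $\ell_1$ and $\ell_2$ such that when setting $\ell_1=\ell_2=0$ all of $Q,Q_1,Q_2$ vanish (i.e. $Q,Q_1,Q_2\in\sqrt{(\ell_1,\ell_2)}$).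
   Context: A linear function is a homogeneous linear form in $x_1,\dots,x_n$ over $\mathbb{C}$ (possibly zero). *)

theory Defs
  imports "HOL-Analysis.Analysis" "HOL-Library.Poly_Mapping"
begin

text \<open>
  Polynomials in the variables \<open>x\<^sub>i\<close>, \<open>i\<close> ranging over the finite type \<open>'n\<close>, with complex
  coefficients: finitely supported maps from exponent vectors to coefficients. The ring
  operations are those of the library (multiplication is convolution).
\<close>

type_synonym 'n cpoly = "('n \<Rightarrow>\<^sub>0 nat) \<Rightarrow>\<^sub>0 complex"

definition const_poly :: "complex \<Rightarrow> 'n cpoly" where
  "const_poly c = Poly_Mapping.single 0 c"

definition eval_poly :: "'n::finite cpoly \<Rightarrow> complex ^ 'n \<Rightarrow> complex" where
  "eval_poly P p =
    (\<Sum>m\<in>Poly_Mapping.keys P. Poly_Mapping.lookup P m * (\<Prod>i\<in>UNIV. p $ i ^ Poly_Mapping.lookup m i))"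

text \<open>The zero polynomial is homogeneous of every degree.\<close>

definition homogeneous :: "nat \<Rightarrow> 'n::finite cpoly \<Rightarrow> bool" where
  "homogeneous d P \<longleftrightarrow> (\<forall>m\<in>Poly_Mapping.keys P. (\<Sum>i\<in>UNIV. Poly_Mapping.lookup m i) = d)"

abbreviation linear_form :: "'n::finite cpoly \<Rightarrow> bool" where
  "linear_form \<equiv> homogeneous 1"

abbreviation quadratic_form :: "'n::finite cpoly \<Rightarrow> bool" where
  "quadratic_form \<equiv> homogeneous 2"

end

theory Submission
  imports Defs "HOL-Computational_Algebra.Fundamental_Theorem_Algebra"
begin

text \<open>
  Over \<open>\<complex>\<close> a quadratic form is the diagonal \<open>x \<mapsto> b x x\<close> of a symmetric bilinear form \<open>b\<close>, and
  everything except the translation from and to polynomials happens with such forms \<open>a\<close>, \<open>b\<close>, \<open>g\<close>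
  (for \<open>Q1\<close>, \<open>Q2\<close>, \<open>Q\<close>) and linear functionals on \<open>\<complex>\<^sup>n\<close>. The three alternatives depend only on the
  pencil spanned by \<open>a\<close> and \<open>b\<close>, so any basis of the pencil may be used.

  If the pencil contains a product \<open>l m\<close> of linear functionals (\<open>trichotomy_reducible\<close>), the common
  zeros split into those of \<open>b\<close> on the hyperplanes \<open>l = 0\<close> and \<open>m = 0\<close>. On each hyperplane, \<open>g\<close> is a
  multiple of \<open>b\<close> unless \<open>b\<close> factors there, and a linear factor of \<open>b\<close> gives a subspace of codimension
  at most two on which both forms vanish. The two multiples are the same \<open>c b\<close>, unless \<open>b\<close> vanishes on
  the intersection of the hyperplanes, which is again such a subspace. If they are the same, \<open>g - c b\<close>
  is divisible by \<open>l m\<close>, so \<open>g\<close> is in the span.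

  Otherwise there is a pencil member, again called \<open>a\<close>, that is singular at a vector \<open>v\<close> outside the
  common radical of the pencil (\<open>pencil_vertex\<close>), as \<open>\<lambda> a + b\<close> degenerates at an eigenvalue. As \<open>a\<close>
  does not change along \<open>v\<close>, the zeros of \<open>a\<close> can be moved along \<open>v\<close> until \<open>b\<close> vanishes. If
  \<open>b v v \<noteq> 0\<close> this is a square root (\<open>trichotomy_vertex_outside\<close>): both signs give common zeros, and
  the equations for \<open>g\<close> at both show that \<open>g\<close> is in the span or that \<open>b\<close> is a square modulo \<open>a\<close>.
  If \<open>b v v = 0\<close> it is a division (\<open>trichotomy_vertex_inside\<close>): with \<open>M = b v\<close> and \<open>L = g v\<close> it yields
  that the cubic \<open>g M - b L\<close> vanishes on the zeros of \<open>a\<close> with \<open>M \<noteq> 0\<close>, hence equals \<open>a k\<close> with \<open>k\<close> linear. The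
  identity \<open>b L = - a k\<close> on the hyperplane \<open>M = 0\<close> then leads to one of the alternatives.

  The only divisibility fact behind this is \<open>cubic_division\<close>, the special case of the
  Nullstellensatz for an irreducible quadric. Complete the square in one variable, \<open>a = s\<^sup>2 - d\<close>, and
  reduce the cubic modulo \<open>a\<close> to \<open>s A + B\<close>; the two points \<open>s = \<plusminus> \<surd>d\<close> over each base point force
  \<open>A = B = 0\<close> generically, hence identically.
\<close>

section \<open>Linear functionals and symmetric bilinear forms\<close>

definition linear_fun :: "(complex ^ 'n \<Rightarrow> complex) \<Rightarrow> bool" where
  "linear_fun l \<longleftrightarrow> (\<forall>x y. l (x + y) = l x + l y) \<and> (\<forall>c x. l (c *s x) = c * l x)"

definition sym_form :: "(complex ^ 'n \<Rightarrow> complex ^ 'n \<Rightarrow> complex) \<Rightarrow> bool" where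
  "sym_form b \<longleftrightarrow> (\<forall>x y. b x y = b y x) \<and> (\<forall>x. linear_fun (b x))"

definition reducible :: "(complex ^ 'n \<Rightarrow> complex ^ 'n \<Rightarrow> complex) \<Rightarrow> bool" where
  "reducible a \<longleftrightarrow> (\<exists>l m. linear_fun l \<and> linear_fun m \<and> (\<forall>x. a x x = l x * m x))"

lemma linear_fun_add: "linear_fun l \<Longrightarrow> l (x + y) = l x + l y"
  and linear_fun_scale: "linear_fun l \<Longrightarrow> l (c *s x) = c * l x"
  by (auto simp: linear_fun_def)

lemma linear_fun_diff: "linear_fun l \<Longrightarrow> l (x - y) = l x - l y"
  using linear_fun_add[of l "x - y" y] by simp

lemma linear_fun_0: "linear_fun l \<Longrightarrow> l 0 = 0"
  using linear_fun_diff[of l 0 0] by simp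

lemmas linear_fun_simps = linear_fun_add linear_fun_diff linear_fun_scale linear_fun_0

lemma linear_fun_zero: "linear_fun (\<lambda>x. 0)"
  by (simp add: linear_fun_def)

lemma linear_fun_lincomb:
  "linear_fun l \<Longrightarrow> linear_fun m \<Longrightarrow> linear_fun (\<lambda>x. c * l x + d * m x)"
  by (simp add: linear_fun_def algebra_simps)

lemma linear_fun_mult: "linear_fun l \<Longrightarrow> linear_fun (\<lambda>x. c * l x)"
  by (simp add: linear_fun_def algebra_simps)

lemma linear_fun_plus: "linear_fun l \<Longrightarrow> linear_fun m \<Longrightarrow> linear_fun (\<lambda>x. l x + m x)"
  by (simp add: linear_fun_def algebra_simps)

lemma linear_fun_minus: "linear_fun l \<Longrightarrow> linear_fun m \<Longrightarrow> linear_fun (\<lambda>x. l x - m x)"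
  by (simp add: linear_fun_def algebra_simps)

lemma linear_fun_project:
  "linear_fun l \<Longrightarrow> linear_fun m \<Longrightarrow> linear_fun (\<lambda>x. m (x - l x *s u))"
  unfolding linear_fun_def[of "\<lambda>x. m (x - l x *s u)"]
  by (simp add: linear_fun_simps algebra_simps)

lemma sym_formD: "sym_form b \<Longrightarrow> linear_fun (b x)" "sym_form b \<Longrightarrow> b x y = b y x"
  by (auto simp: sym_form_def)

lemma sym_form_left: "sym_form b \<Longrightarrow> linear_fun (\<lambda>x. b x y)"
proof -
  assume b: "sym_form b"
  hence "(\<lambda>x. b x y) = b y" by (auto simp: sym_form_def)
  thus ?thesis using sym_formD(1)[OF b, of y] by simp
qed

lemma sym_form_simps:
  assumes "sym_form b"
  shows "b (x + y) z = b x z + b y z" "b (x - y) z = b x z - b y z" "b (c *s x) z = c * b x z"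
    "b z (x + y) = b z x + b z y" "b z (x - y) = b z x - b z y" "b z (c *s x) = c * b z x"
    "b 0 z = 0" "b z 0 = 0"
  using linear_fun_simps[OF sym_form_left[OF assms]] linear_fun_simps[OF sym_formD(1)[OF assms]]
  by auto

lemma sym_form_expand:
  assumes "sym_form b"
  shows "b (s *s u + z) (s *s u + z) = s\<^sup>2 * b u u + 2 * s * b u z + b z z"
  using sym_formD(2)[OF assms, of z u]
  by (simp add: sym_form_simps[OF assms] algebra_simps power2_eq_square)

lemma sym_form_lincomb:
  "sym_form a \<Longrightarrow> sym_form b \<Longrightarrow> sym_form (\<lambda>x y. c * a x y + d * b x y)"
  unfolding sym_form_def by (auto intro!: linear_fun_lincomb)

lemma sym_form_zero: "sym_form (\<lambda>x y. 0)"
  unfolding sym_form_def by (auto intro!: linear_fun_zero)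

lemma sym_form_diff:
  "sym_form a \<Longrightarrow> sym_form b \<Longrightarrow> sym_form (\<lambda>x y. a x y - c * b x y)"
  unfolding sym_form_def by (auto intro!: linear_fun_minus linear_fun_mult)

lemma sym_form_project:
  assumes "sym_form b" "linear_fun l"
  shows "sym_form (\<lambda>x y. b (x - l x *s u) (y - l y *s u))"
  using assms(1) linear_fun_project[OF assms(2) sym_formD(1)[OF assms(1)]]
  unfolding sym_form_def by blast

section \<open>Functions that are polynomial along lines\<close>

text \<open>
  Polynomial functions enter only through their restrictions to lines: this weak notion is closed
  under ring operations and suffices for the density argument
  \<open>line_polynomial_product_zero_on\<close>.
\<close>

definition line_polynomial :: "(complex ^ 'n \<Rightarrow> complex) \<Rightarrow> bool" where
  "line_polynomial f \<longleftrightarrow> (\<forall>x y. \<exists>p. \<forall>t. f (x + t *s y) = poly p t)"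

text \<open>
  A common source of the closure properties: \<open>F\<close> is an operation on values and \<open>G\<close> the matching
  operation on univariate polynomials.
\<close>

lemma line_polynomialI2:
  assumes "line_polynomial f" "line_polynomial g" "\<And>p q t. poly (G p q) t = F (poly p t) (poly q t)"
  shows "line_polynomial (\<lambda>x. F (f x) (g x))"
  unfolding line_polynomial_def
proof (intro allI)
  fix x y
  obtain p where "\<And>t. f (x + t *s y) = poly p t"
    using assms(1) unfolding line_polynomial_def by blast
  moreover obtain q where "\<And>t. g (x + t *s y) = poly q t"
    using assms(2) unfolding line_polynomial_def by blast
  ultimately show "\<exists>r. \<forall>t. F (f (x + t *s y)) (g (x + t *s y)) = poly r t"
    by (intro exI[of _ "G p q"]) (simp add: assms(3))
qed

lemma line_polynomial_const: "line_polynomial (\<lambda>x. c)"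
  unfolding line_polynomial_def by (intro allI exI[of _ "[:c:]"]) simp

lemma line_polynomial_add:
  assumes "line_polynomial f" "line_polynomial g" shows "line_polynomial (\<lambda>x. f x + g x)"
  by (intro line_polynomialI2[OF assms, of "(+)" "(+)"]) simp_all

lemma line_polynomial_mult:
  assumes "line_polynomial f" "line_polynomial g" shows "line_polynomial (\<lambda>x. f x * g x)"
  by (intro line_polynomialI2[OF assms, of "(*)" "(*)"]) simp_all

lemma line_polynomial_diff:
  assumes "line_polynomial f" "line_polynomial g" shows "line_polynomial (\<lambda>x. f x - g x)"
  by (intro line_polynomialI2[OF assms, of "(-)" "(-)"]) simp_all

lemma line_polynomial_power:
  assumes "line_polynomial f" shows "line_polynomial (\<lambda>x. f x ^ k)"
  by (rule line_polynomialI2[OF assms assms, of "\<lambda>p q. p ^ k"]) simp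

lemmas line_polynomial_intros = line_polynomial_add line_polynomial_diff line_polynomial_mult
  line_polynomial_power line_polynomial_const

lemma line_polynomial_linear:
  assumes "linear_fun l" shows "line_polynomial l"
  unfolding line_polynomial_def
proof (intro allI)
  fix x y show "\<exists>p. \<forall>t. l (x + t *s y) = poly p t"
    by (rule exI[of _ "[:l x, l y:]"]) (simp add: linear_fun_simps[OF assms])
qed

lemma line_polynomial_form:
  assumes "sym_form b" shows "line_polynomial (\<lambda>x. b x x)"
  unfolding line_polynomial_def
proof (intro allI)
  fix x y show "\<exists>p. \<forall>t. b (x + t *s y) (x + t *s y) = poly p t"
    by (rule exI[of _ "[:b x x, 2 * b y x, b y y:]"])
       (use sym_form_expand[OF assms, of _ y x] in
         \<open>simp add: add.commute[of x] power2_eq_square ring_distribs mult.assoc mult.left_commute\<close>)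
qed

text \<open>
  On an affine subspace the ring of polynomial functions has no zero divisors: join a point where
  \<open>f\<close> is nonzero to one where \<open>g\<close> is nonzero, and use that univariate polynomials form a domain.
  This is what turns identities at generic points into identities everywhere.
\<close>

lemma line_polynomial_product_zero_on:
  assumes f: "line_polynomial f" and g: "line_polynomial g"
    and S: "\<And>x y t. x \<in> S \<Longrightarrow> y \<in> S \<Longrightarrow> x + t *s (y - x) \<in> S"
    and fg: "\<And>x. x \<in> S \<Longrightarrow> f x * g x = 0"
  shows "(\<forall>x\<in>S. f x = 0) \<or> (\<forall>x\<in>S. g x = 0)"
proof (rule ccontr)
  assume "\<not> ?thesis"
  then obtain x y where xy: "x \<in> S" "y \<in> S" and x: "f x \<noteq> 0" and y: "g y \<noteq> 0" by blast
  obtain p where p: "\<And>t. f (x + t *s (y - x)) = poly p t"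
    using f unfolding line_polynomial_def by blast
  obtain q where q: "\<And>t. g (x + t *s (y - x)) = poly q t"
    using g unfolding line_polynomial_def by blast
  have "poly (p * q) t = 0" for t
    using fg[OF S[OF xy, of t]] by (simp only: p q poly_mult)
  hence "p * q = 0" using poly_all_0_iff_0 by blast
  moreover have "poly p 0 \<noteq> 0" using p[of 0] x by simp
  moreover have "poly q 1 \<noteq> 0" using q[of 1] y by simp
  ultimately show False by auto
qed

lemma line_polynomial_product_zero:
  assumes "line_polynomial f" "line_polynomial g" "\<And>x. f x * g x = 0"
  shows "(\<forall>x. f x = 0) \<or> (\<forall>x. g x = 0)"
  using line_polynomial_product_zero_on[of f g UNIV] assms by auto

section \<open>Divisibility by a linear functional and by an irreducible form\<close>

lemma linear_multiple:
  assumes l: "linear_fun l" and m: "linear_fun m" and van: "\<And>x. m x = 0 \<Longrightarrow> l x = 0"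
  shows "\<exists>c. \<forall>x. l x = c * m x"
proof (cases "\<forall>x. m x = 0")
  case True thus ?thesis using van by auto
next
  case False
  then obtain u where u: "m u \<noteq> 0" by blast
  have "l x = l u / m u * m x" for x
  proof -
    have "m (x - (m x / m u) *s u) = 0" using u by (simp add: linear_fun_simps[OF m])
    from van[OF this] show ?thesis using u by (simp add: linear_fun_simps[OF l])
  qed
  thus ?thesis by blast
qed

lemma exists_normalized:
  assumes "linear_fun l" "\<not> (\<forall>x. l x = 0)"
  shows "\<exists>u. l u = 1"
proof -
  obtain w where "l w \<noteq> 0" using assms by blast
  hence "l ((1 / l w) *s w) = 1" by (simp add: linear_fun_simps[OF assms(1)])
  thus ?thesis ..
qed

text \<open>
  Writing \<open>x = l x *s u + z\<close> with \<open>l u = 1\<close> and \<open>l z = 0\<close>, the only term of \<open>a x x\<close> without a factor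
  \<open>l x\<close> is \<open>a z z = 0\<close>.
\<close>

lemma form_divisible_by_linear:
  assumes a: "sym_form a" and l: "linear_fun l" and nz: "\<not> (\<forall>x. l x = 0)"
    and van: "\<And>x. l x = 0 \<Longrightarrow> a x x = 0"
  shows "\<exists>m. linear_fun m \<and> (\<forall>x. a x x = l x * m x)"
proof -
  obtain u where u: "l u = 1" using exists_normalized[OF l nz] by blast
  let ?m = "\<lambda>x. 2 * a u x - a u u * l x"
  have "linear_fun ?m" by (intro linear_fun_minus linear_fun_mult sym_formD(1)[OF a] l)
  moreover have "a x x = l x * ?m x" for x
  proof -
    let ?z = "x - l x *s u"
    have z: "l ?z = 0" by (simp add: linear_fun_simps[OF l] u)
    have "a x x = (l x)\<^sup>2 * a u u + 2 * l x * a u ?z + a ?z ?z"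
      using sym_form_expand[OF a, of "l x" u ?z] by simp
    also have "\<dots> = l x * ?m x"
      using van[OF z] by (simp add: sym_form_simps[OF a] algebra_simps power2_eq_square)
    finally show ?thesis .
  qed
  ultimately show ?thesis by blast
qed

text \<open>
  The cubic \<open>g M - b L\<close> is divisible by the irreducible \<open>a\<close> as soon as it vanishes on the zeros of
  \<open>a\<close> outside the hyperplane \<open>M = 0\<close>. Normalise \<open>a y y = 1\<close> and use the coordinate \<open>s = a y\<close>, so that
  \<open>a = s\<^sup>2 - d\<close> with \<open>d\<close> independent of \<open>s\<close>. Division with remainder by \<open>a\<close> gives the remainder
  \<open>s A + B\<close>. Over a base point with \<open>d \<noteq> 0\<close> there are two zeros of \<open>a\<close>, with values \<open>\<plusminus> \<surd>d\<close> of \<open>s\<close>; the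
  product of the values of \<open>M\<close> at them is \<open>N\<close>. If \<open>N \<noteq> 0\<close> too, the remainder vanishes at both and thus
  \<open>A = B = 0\<close>. Irreducibility enters twice: \<open>d = 0\<close> would make \<open>a\<close> the square of \<open>s\<close>, and \<open>N = 0\<close> would
  make \<open>d\<close> the square of a linear functional, or \<open>M\<close> zero.
\<close>

lemma cubic_division:
  fixes a b g :: "complex ^ 'n \<Rightarrow> complex ^ 'n \<Rightarrow> complex"
  assumes a: "sym_form a" and b: "sym_form b" and g: "sym_form g"
    and L: "linear_fun L" and M: "linear_fun M"
    and irr: "\<not> reducible a" and nz: "\<not> (\<forall>x. M x = 0)"
    and van: "\<And>x. a x x = 0 \<Longrightarrow> M x \<noteq> 0 \<Longrightarrow> g x x * M x - b x x * L x = 0"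
  shows "\<exists>k. linear_fun k \<and> (\<forall>x. g x x * M x - b x x * L x = a x x * k x)"
proof -
  obtain y where y: "a y y = 1"
  proof -
    have "\<not> (\<forall>x. a x x = 0)"
    proof
      assume "\<forall>x. a x x = 0"
      hence "\<forall>x. a x x = (\<lambda>x. 0) x * (\<lambda>x. 0) x" by simp
      thus False using irr linear_fun_zero unfolding reducible_def by blast
    qed
    then obtain w where w: "a w w \<noteq> 0" by blast
    have "a ((1 / csqrt (a w w)) *s w) ((1 / csqrt (a w w)) *s w) = 1"
      using w power2_csqrt[of "a w w"]
      by (simp add: sym_form_simps[OF a] power2_eq_square)
    thus ?thesis using that by blast
  qed
  define s where "s = a y"
  have s: "linear_fun s" using sym_formD(1)[OF a] by (simp add: s_def)
  have sy: "s y = 1" by (simp add: s_def y)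
  define P where "P = (\<lambda>x. x - s x *s y)"
  have sP: "s (P x) = 0" for x by (simp add: P_def linear_fun_simps[OF s] sy)
  have Px: "x = s x *s y + P x" for x by (simp add: P_def)
  have ax: "a (e *s y + P x) (e *s y + P x) = e\<^sup>2 + a (P x) (P x)" for e x
    using sP[of x] by (simp add: sym_form_expand[OF a] y s_def)
  (* Division of b x x * L x by a x x = s\<^sup>2 + a z z, where z = P x: quotient k, remainder s A + B. *)
  define A where "A = (\<lambda>b L x. 2 * b y (P x) * L (P x) + b (P x) (P x) * L y
      - a (P x) (P x) * b y y * L y)"
  define B where "B = (\<lambda>b L x. b (P x) (P x) * L (P x)
      - a (P x) (P x) * (b y y * L (P x) + 2 * b y (P x) * L y))"
  define k where "k = (\<lambda>b L x. b y y * L y * s x + (b y y * L (P x) + 2 * L y * b y (P x)))"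
  have dec: "b (e *s y + P x) (e *s y + P x) * L (e *s y + P x) =
      (e\<^sup>2 + a (P x) (P x)) * (b y y * L y * e + (b y y * L (P x) + 2 * L y * b y (P x)))
      + e * A b L x + B b L x"
    if b: "sym_form b" and L: "linear_fun L"
    for b :: "complex ^ 'n \<Rightarrow> complex ^ 'n \<Rightarrow> complex" and L e x
    by (simp add: sym_form_expand[OF b] linear_fun_simps[OF L] A_def B_def)
       (simp add: algebra_simps power2_eq_square)
  have pol: "line_polynomial (A b L)" "line_polynomial (B b L)" "linear_fun (k b L)"
    if b: "sym_form b" and L: "linear_fun L" for b :: "complex ^ 'n \<Rightarrow> complex ^ 'n \<Rightarrow> complex" and L
  proof -
    have LP: "linear_fun (\<lambda>x. L (P x))" and bP: "linear_fun (\<lambda>x. b y (P x))"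
      unfolding P_def by (intro linear_fun_project s L sym_formD(1)[OF b])+
    have qb: "line_polynomial (\<lambda>x. b (P x) (P x))" and qa: "line_polynomial (\<lambda>x. a (P x) (P x))"
      unfolding P_def
      by (intro line_polynomial_form[OF sym_form_project[OF b s]]
          line_polynomial_form[OF sym_form_project[OF a s]])+
    note lp = line_polynomial_linear[OF LP] line_polynomial_linear[OF bP] qa qb
    show "line_polynomial (A b L)"
      unfolding A_def by (intro line_polynomial_intros lp)
    show "line_polynomial (B b L)"
      unfolding B_def by (intro line_polynomial_intros lp)
    show "linear_fun (k b L)"
      unfolding k_def by (intro linear_fun_plus linear_fun_mult LP bP s)
  qed
  define A' where "A' = (\<lambda>x. A g M x - A b L x)"
  define B' where "B' = (\<lambda>x. B g M x - B b L x)"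
  define N where "N = (\<lambda>x. (M (P x))\<^sup>2 + a (P x) (P x) * (M y)\<^sup>2)"
  define d where "d = (\<lambda>x. - 1 * a (P x) (P x))"
  have AB: "(N x = 0 \<or> d x = 0 \<or> A' x = 0) \<and> (N x = 0 \<or> d x = 0 \<or> B' x = 0)" for x
  proof (cases "N x = 0 \<or> d x = 0")
    case False
    define e where "e = csqrt (d x)"
    have e2: "e\<^sup>2 = d x" by (simp add: e_def)
    have e0: "e \<noteq> 0" using False e2 by auto
    have key: "h * A' x + B' x = 0" if h: "h\<^sup>2 = d x" for h
    proof -
      let ?w = "h *s y + P x"
      have a0: "h\<^sup>2 + a (P x) (P x) = 0" using h by (simp add: d_def)
      (* The second factor is the value of M at the other zero, with - h in place of h. *)
      have "M ?w * (M (P x) - h * M y) = (M (P x))\<^sup>2 - h\<^sup>2 * (M y)\<^sup>2"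
        by (simp add: linear_fun_simps[OF M] algebra_simps power2_eq_square)
      also have "\<dots> = N x" by (simp add: h N_def d_def)
      finally have "M ?w * (M (P x) - h * M y) = N x" .
      hence Mw: "M ?w \<noteq> 0" using False by auto
      have "a ?w ?w = 0" using a0 by (simp add: ax)
      from van[OF this Mw] show ?thesis
        unfolding dec[OF g M] dec[OF b L] a0 by (simp add: A'_def B'_def algebra_simps)
    qed
    have "e * A' x + B' x = 0" "- e * A' x + B' x = 0" using key[of e] key[of "- e"] e2 by auto
    hence "B' x = 0" "A' x = 0" using e0 by (auto simp: algebra_simps eq_neg_iff_add_eq_0)
    thus ?thesis by simp
  qed auto
  have pA: "line_polynomial A'" and pB: "line_polynomial B'"
    unfolding A'_def B'_def by (intro line_polynomial_diff pol g M b L)+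
  have pd: "line_polynomial d"
    unfolding P_def d_def
    by (intro line_polynomial_intros line_polynomial_form[OF sym_form_project[OF a s]])
  have lMP: "linear_fun (\<lambda>x. M (P x))" unfolding P_def by (intro linear_fun_project s M)
  have pN: "line_polynomial N"
    unfolding N_def P_def
    by (intro line_polynomial_intros line_polynomial_form[OF sym_form_project[OF a s]]
      line_polynomial_linear[OF lMP[unfolded P_def]])
  have d0: "\<not> (\<forall>x. d x = 0)"
  proof
    assume d: "\<forall>x. d x = 0"
    have "a x x = s x * s x" for x
      using ax[of "s x" x] d[rule_format, of x] Px[of x] by (simp add: d_def power2_eq_square)
    thus False using irr s unfolding reducible_def by blast
  qed
  have N0: "\<not> (\<forall>x. N x = 0)"
  proof
    assume N: "\<forall>x. N x = 0"
    show False
    proof (cases "M y = 0")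
      case True
      have "M x = 0" for x
      proof -
        have "M (P x) = 0" using N[rule_format, of x] True by (simp add: N_def)
        thus ?thesis using Px[of x] True linear_fun_simps[OF M] by (metis add.right_neutral mult_zero_right)
      qed
      thus False using nz by blast
    next
      case False
      let ?r = "\<lambda>x. (1 / M y) * M (P x)"
      have r: "linear_fun ?r" by (intro linear_fun_mult lMP)
      have "a x x = (s x + ?r x) * (s x - ?r x)" for x
      proof -
        have "a (P x) (P x) = - (?r x)\<^sup>2"
        proof -
          have "a (P x) (P x) * (M y)\<^sup>2 = - (M (P x))\<^sup>2"
            using N[rule_format, of x] by (simp add: N_def eq_neg_iff_add_eq_0 add.commute)
          thus ?thesis using False by (simp add: field_simps)
        qed
        thus ?thesis using ax[of "s x" x] Px[of x] by (simp add: algebra_simps power2_eq_square)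
      qed
      hence "reducible a"
        unfolding reducible_def using linear_fun_plus[OF s r] linear_fun_minus[OF s r]
        by (intro exI[of _ "\<lambda>x. s x + ?r x"] exI[of _ "\<lambda>x. s x - ?r x"]) simp
      thus False using irr by contradiction
    qed
  qed
  have zero: "\<forall>x. F x = 0" if F: "line_polynomial F" "\<And>x. N x = 0 \<or> d x = 0 \<or> F x = 0" for F
  proof -
    have "(\<forall>x. N x = 0) \<or> (\<forall>x. d x * F x = 0)"
      using F(2) by (intro line_polynomial_product_zero pN line_polynomial_mult pd F(1)) auto
    hence "(\<forall>x. d x = 0) \<or> (\<forall>x. F x = 0)"
      using N0 by (intro line_polynomial_product_zero pd F(1)) auto
    thus ?thesis using d0 by blast
  qed
  have A0: "A' x = 0" and B0: "B' x = 0" for x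
    using zero[OF pA] zero[OF pB] AB by blast+
  have "g x x * M x - b x x * L x = a x x * (k g M x - k b L x)" for x
  proof -
    have "g x x * M x - b x x * L x = (g (s x *s y + P x) (s x *s y + P x) * M (s x *s y + P x))
        - (b (s x *s y + P x) (s x *s y + P x) * L (s x *s y + P x))"
      using Px[of x] by simp
    also have "\<dots> = ((s x)\<^sup>2 + a (P x) (P x)) * (k g M x - k b L x) + s x * A' x + B' x"
      unfolding dec[OF g M] dec[OF b L] by (simp add: k_def A'_def B'_def algebra_simps)
    also have "\<dots> = a x x * (k g M x - k b L x)"
      using ax[of "s x" x] Px[of x] A0 B0 by simp
    finally show ?thesis .
  qed
  thus ?thesis using linear_fun_minus[OF pol(3)[OF g M] pol(3)[OF b L]] by blast
qed

text \<open>
  Multiplying \<open>g\<close> by \<open>M\<close> reduces this to \<open>cubic_division\<close>: \<open>g M = a k\<close>. On \<open>M = 0\<close> the factor \<open>a\<close> does not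
  vanish identically, being irreducible, so \<open>k\<close> does and is a multiple of \<open>M\<close>, which cancels.
\<close>

lemma form_multiple:
  assumes a: "sym_form a" and g: "sym_form g" and M: "linear_fun M"
    and irr: "\<not> reducible a" and nz: "\<not> (\<forall>x. M x = 0)"
    and van: "\<And>x. a x x = 0 \<Longrightarrow> M x \<noteq> 0 \<Longrightarrow> g x x = 0"
  shows "\<exists>c. \<forall>x. g x x = c * a x x"
proof -
  obtain k where k: "linear_fun k" and gk: "\<And>x. g x x * M x = a x x * k x"
    using cubic_division[OF a sym_form_zero g linear_fun_zero M irr nz] van by auto
  let ?S = "{x. M x = 0}"
  have "(\<forall>x\<in>?S. a x x = 0) \<or> (\<forall>x\<in>?S. k x = 0)"
  proof (rule line_polynomial_product_zero_on)
    show "x + t *s (y - x) \<in> ?S" if "x \<in> ?S" "y \<in> ?S" for x y t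
      using that by (simp add: linear_fun_simps[OF M])
    show "a x x * k x = 0" if "x \<in> ?S" for x
      using that gk[of x] by simp
  qed (intro line_polynomial_form[OF a] line_polynomial_linear[OF k])+
  moreover have "\<not> (\<forall>x\<in>?S. a x x = 0)"
    using form_divisible_by_linear[OF a M nz] irr M unfolding reducible_def by blast
  ultimately obtain c where c: "\<And>x. k x = c * M x"
    using linear_multiple[OF k M] by auto
  have "M x * (g x x - c * a x x) = 0" for x
    using gk[of x] by (simp add: c algebra_simps)
  hence "(\<forall>x. M x = 0) \<or> (\<forall>x. g x x - c * a x x = 0)"
    by (intro line_polynomial_product_zero line_polynomial_intros line_polynomial_linear[OF M]
        line_polynomial_form a g)
  thus ?thesis using nz by auto
qed

section \<open>Pencils with a reducible member\<close>

text \<open>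
  The three alternatives for forms. The last one does not mention \<open>g\<close>: wherever \<open>trichotomy\<close>
  is proved, \<open>g\<close> is assumed to vanish at the common zeros of \<open>a\<close> and \<open>b\<close>.
\<close>

definition trichotomy where
  "trichotomy a b g \<longleftrightarrow>
    (\<exists>\<alpha> \<beta>. \<forall>x. g x x = \<alpha> * a x x + \<beta> * b x x)
    \<or> (\<exists>\<alpha> \<beta> l. \<not> (\<alpha> = 0 \<and> \<beta> = 0) \<and> linear_fun l \<and> (\<forall>x. \<alpha> * a x x + \<beta> * b x x = (l x)\<^sup>2))
    \<or> (\<exists>l m. linear_fun l \<and> linear_fun m \<and> (\<forall>x. l x = 0 \<and> m x = 0 \<longrightarrow> a x x = 0 \<and> b x x = 0))"

lemma trichotomy_span: "(\<And>x. g x x = \<alpha> * a x x + \<beta> * b x x) \<Longrightarrow> trichotomy a b g"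
  unfolding trichotomy_def by blast

lemma trichotomy_square:
  "\<not> (\<alpha> = 0 \<and> \<beta> = 0) \<Longrightarrow> linear_fun l \<Longrightarrow> (\<And>x. \<alpha> * a x x + \<beta> * b x x = (l x)\<^sup>2)
    \<Longrightarrow> trichotomy a b g"
  unfolding trichotomy_def by blast

lemma trichotomy_linear:
  "linear_fun l \<Longrightarrow> linear_fun m \<Longrightarrow> (\<And>x. l x = 0 \<Longrightarrow> m x = 0 \<Longrightarrow> a x x = 0 \<and> b x x = 0)
    \<Longrightarrow> trichotomy a b g"
  unfolding trichotomy_def by blast

lemma trichotomy_change_basis:
  assumes a': "\<And>x. a' x x = \<alpha> * a x x + \<beta> * b x x"
    and b': "\<And>x. b' x x = \<gamma> * a x x + \<delta> * b x x"
    and D: "\<alpha> * \<delta> - \<beta> * \<gamma> \<noteq> 0" and T: "trichotomy a' b' g"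
  shows "trichotomy a b g"
  using T unfolding trichotomy_def[of a' b']
proof (elim disjE exE conjE)
  fix c d assume "\<forall>x. g x x = c * a' x x + d * b' x x"
  hence "g x x = (c * \<alpha> + d * \<gamma>) * a x x + (c * \<beta> + d * \<delta>) * b x x" for x
    by (simp add: a' b' algebra_simps)
  thus ?thesis by (rule trichotomy_span)
next
  fix c d l assume cd: "\<not> (c = 0 \<and> d = 0)" and l: "linear_fun l"
    and eq: "\<forall>x. c * a' x x + d * b' x x = (l x)\<^sup>2"
  have "(c * \<alpha> + d * \<gamma>) * a x x + (c * \<beta> + d * \<delta>) * b x x = (l x)\<^sup>2" for x
    using eq[rule_format, of x] by (simp add: a' b' algebra_simps)
  moreover have "\<not> (c * \<alpha> + d * \<gamma> = 0 \<and> c * \<beta> + d * \<delta> = 0)"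
  proof
    assume z: "c * \<alpha> + d * \<gamma> = 0 \<and> c * \<beta> + d * \<delta> = 0"
    have "c * (\<alpha> * \<delta> - \<beta> * \<gamma>) = \<delta> * (c * \<alpha> + d * \<gamma>) - \<gamma> * (c * \<beta> + d * \<delta>)"
      "d * (\<alpha> * \<delta> - \<beta> * \<gamma>) = \<alpha> * (c * \<beta> + d * \<delta>) - \<beta> * (c * \<alpha> + d * \<gamma>)"
      by (simp_all add: algebra_simps)
    thus False using z D cd by simp
  qed
  ultimately show ?thesis using l by (intro trichotomy_square)
next
  fix l m assume lm: "linear_fun l" "linear_fun m"
    and van: "\<forall>x. l x = 0 \<and> m x = 0 \<longrightarrow> a' x x = 0 \<and> b' x x = 0"
  have "a x x = 0 \<and> b x x = 0" if "l x = 0" "m x = 0" for x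
  proof -
    have z: "a' x x = 0" "b' x x = 0" using van that by auto
    have "a x x * (\<alpha> * \<delta> - \<beta> * \<gamma>) = \<delta> * a' x x - \<beta> * b' x x"
      "b x x * (\<alpha> * \<delta> - \<beta> * \<gamma>) = \<alpha> * b' x x - \<gamma> * a' x x"
      by (simp_all add: a' b' algebra_simps)
    thus ?thesis using z D by simp
  qed
  thus ?thesis using lm by (intro trichotomy_linear)
qed

text \<open>
  Here \<open>a = l m\<close>, and \<open>l\<close> and \<open>m\<close> are independent since otherwise \<open>a\<close> is a square. Composing with a
  projection onto the hyperplane \<open>l = 0\<close> makes \<open>form_multiple\<close> applicable to the restrictions of \<open>b\<close>
  and \<open>g\<close>, unless the restriction of \<open>b\<close> has a linear factor \<open>r\<close>, and then \<open>a\<close> and \<open>b\<close> vanish on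
  \<open>l = r = 0\<close>.
\<close>

lemma trichotomy_reducible:
  fixes a b g :: "complex ^ 'n \<Rightarrow> complex ^ 'n \<Rightarrow> complex"
  assumes a: "sym_form a" and b: "sym_form b" and g: "sym_form g" and red: "reducible a"
    and van: "\<And>x. a x x = 0 \<Longrightarrow> b x x = 0 \<Longrightarrow> g x x = 0"
  shows "trichotomy a b g"
proof (rule ccontr)
  assume neg: "\<not> trichotomy a b g"
  obtain l m where l: "linear_fun l" and m: "linear_fun m" and lm: "\<And>x. a x x = l x * m x"
    using red unfolding reducible_def by blast
  have indep: "\<exists>x. l x = 0 \<and> m x \<noteq> 0"
    if l: "linear_fun l" and m: "linear_fun m" and lm: "\<And>x. a x x = l x * m x" for l m
  proof (rule ccontr)
    assume "\<not> ?thesis"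
    then obtain c where "\<And>x. m x = c * l x" using linear_multiple[OF m l] by blast
    hence "1 * a x x + 0 * b x x = (csqrt c * l x)\<^sup>2" for x
      by (simp add: lm power_mult_distrib) (simp add: power2_eq_square)
    hence "trichotomy a b g" using l
      by (intro trichotomy_square[of 1 0 "\<lambda>x. csqrt c * l x"] linear_fun_mult) auto
    thus False using neg by blast
  qed
  obtain p where p: "l p = 0" "m p \<noteq> 0" using indep[OF l m lm] by blast
  obtain q where q: "m q = 0" "l q \<noteq> 0"
    using indep[OF m l] lm by (metis mult.commute)
  have hyper: "\<exists>c. \<forall>x. l x = 0 \<longrightarrow> g x x = c * b x x"
    if l: "linear_fun l" and nz: "\<not> (\<forall>x. l x = 0)" and la: "\<And>x. l x = 0 \<Longrightarrow> a x x = 0" for l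
  proof -
    obtain u where u: "l u = 1" using exists_normalized[OF l nz] by blast
    define P where "P = (\<lambda>x. x - l x *s u)"
    have lP: "l (P x) = 0" for x by (simp add: P_def linear_fun_simps[OF l] u)
    have P: "P x = x" if "l x = 0" for x using that by (simp add: P_def)
    have bP: "sym_form (\<lambda>x y. b (P x) (P y))" and gP: "sym_form (\<lambda>x y. g (P x) (P y))"
      unfolding P_def by (intro sym_form_project b g l)+
    have "\<not> reducible (\<lambda>x y. b (P x) (P y))"
    proof
      assume "reducible (\<lambda>x y. b (P x) (P y))"
      then obtain r s where r: "linear_fun r" and rs: "\<And>x. b (P x) (P x) = r x * s x"
        unfolding reducible_def by blast
      have "a x x = 0 \<and> b x x = 0" if "l x = 0" "r x = 0" for x
        using la[OF that(1)] rs[of x] P[OF that(1)] that by simp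
      thus False using trichotomy_linear[OF l r] neg by blast
    qed
    from form_multiple[OF bP gP l this nz]
    obtain c where "\<And>x. g (P x) (P x) = c * b (P x) (P x)" using van la[OF lP] by blast
    thus ?thesis using P by metis
  qed
  obtain c where c: "\<And>x. l x = 0 \<Longrightarrow> g x x = c * b x x"
    using hyper[OF l] q(2) lm by auto
  obtain d where d: "\<And>x. m x = 0 \<Longrightarrow> g x x = d * b x x"
    using hyper[OF m] p(2) lm by auto
  have "c = d"
  proof (rule ccontr)
    assume "c \<noteq> d"
    have "a x x = 0 \<and> b x x = 0" if "l x = 0" "m x = 0" for x
      using c[OF that(1)] d[OF that(2)] \<open>c \<noteq> d\<close> that by (simp add: lm)
    thus False using trichotomy_linear[OF l m] neg by blast
  qed
  have h: "sym_form (\<lambda>x y. g x y - c * b x y)" by (intro sym_form_diff g b)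
  obtain k where k: "linear_fun k" and gk: "\<And>x. g x x - c * b x x = l x * k x"
    using form_divisible_by_linear[OF h l] q(2) c by auto
  let ?S = "{x. m x = 0}"
  have "(\<forall>x\<in>?S. l x = 0) \<or> (\<forall>x\<in>?S. k x = 0)"
  proof (rule line_polynomial_product_zero_on)
    show "x + t *s (y - x) \<in> ?S" if "x \<in> ?S" "y \<in> ?S" for x y t
      using that by (simp add: linear_fun_simps[OF m])
    show "l x * k x = 0" if "x \<in> ?S" for x
      using that gk[of x] d[of x] \<open>c = d\<close> by simp
  qed (intro line_polynomial_linear k l)+
  hence "\<And>x. m x = 0 \<Longrightarrow> k x = 0" using q by auto
  then obtain e where e: "\<And>x. k x = e * m x" using linear_multiple[OF k m] by blast
  have "g x x = e * a x x + c * b x x" for x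
    using gk[of x] by (simp add: e lm algebra_simps)
  thus False using trichotomy_span neg by blast
qed

section \<open>Pencils with an irreducible singular member\<close>

text \<open>
  Split \<open>x = t x *s v + P x\<close> orthogonally with respect to \<open>b\<close>. Subtracting a multiple of \<open>b\<close> from \<open>g\<close>
  gives \<open>h\<close> with \<open>h v v = 0\<close>. Over a zero \<open>x\<close> of \<open>a\<close>, which may be replaced by \<open>P x\<close>, both \<open>e\<close> and \<open>- e\<close>
  with \<open>e\<^sup>2 \<cdot> b v v = - b (P x) (P x)\<close> lead to common zeros \<open>\<plusminus> e *s v + P x\<close>. Adding and subtracting the
  equations for \<open>h\<close> shows that \<open>h (P x) (P x)\<close> and \<open>b (P x) (P x) \<cdot> h v (P x)\<close> vanish on the zeros of \<open>a\<close>.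
  So the former is a multiple of \<open>a\<close>. If the functional \<open>h v (P x)\<close> is zero, \<open>g\<close> is in the span;
  otherwise \<open>b (P x) (P x)\<close> is a multiple of \<open>a\<close> as well, and subtracting it from \<open>b\<close> leaves a square.
\<close>

lemma trichotomy_vertex_outside:
  fixes a b g :: "complex ^ 'n \<Rightarrow> complex ^ 'n \<Rightarrow> complex"
  assumes a: "sym_form a" and b: "sym_form b" and g: "sym_form g"
    and van: "\<And>x. a x x = 0 \<Longrightarrow> b x x = 0 \<Longrightarrow> g x x = 0"
    and irr: "\<not> reducible a" and rad: "\<And>x. a v x = 0" and bv: "b v v \<noteq> 0"
  shows "trichotomy a b g"
proof -
  define \<beta> where "\<beta> = b v v"
  have \<beta>: "\<beta> \<noteq> 0" using bv by (simp add: \<beta>_def)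
  have bl: "linear_fun (b v)" by (rule sym_formD(1)[OF b])
  have bnz: "\<not> (\<forall>x. b v x = 0)" using bv by blast
  define t where "t = (\<lambda>x. (1 / \<beta>) * b v x)"
  have t: "linear_fun t" unfolding t_def by (intro linear_fun_mult bl)
  define P where "P = (\<lambda>x. x - t x *s v)"
  have Px: "x = t x *s v + P x" for x by (simp add: P_def)
  have bP: "b v (P x) = 0" for x
    using \<beta> by (simp add: P_def t_def sym_form_simps[OF b]) (simp add: \<beta>_def)
  have aP: "a (e *s v + P x) (e *s v + P x) = a x x" for e x
    using rad sym_form_expand[OF a, of e v "P x"] sym_form_expand[OF a, of "t x" v "P x"] Px[of x]
    by simp
  define h where "h = (\<lambda>x y. g x y - (g v v / \<beta>) * b x y)"
  have h: "sym_form h" unfolding h_def by (intro sym_form_diff g b)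
  have hv: "h v v = 0" using \<beta> by (simp add: h_def \<beta>_def)
  have key: "h (P x) (P x) = 0 \<and> b (P x) (P x) * h v (P x) = 0" if ax: "a x x = 0" for x
  proof -
    define e where "e = csqrt (- b (P x) (P x) / \<beta>)"
    have e2: "e\<^sup>2 * \<beta> = - b (P x) (P x)" using \<beta> by (simp add: e_def)
    have z: "2 * f * h v (P x) + h (P x) (P x) = 0" if f: "f\<^sup>2 = e\<^sup>2" for f
    proof -
      let ?w = "f *s v + P x"
      have "a ?w ?w = 0" using aP ax by simp
      moreover have "b ?w ?w = 0"
        using e2 by (simp add: sym_form_expand[OF b] bP f \<beta>_def)
      ultimately have "h ?w ?w = 0" using van by (simp add: h_def)
      thus ?thesis by (simp add: sym_form_expand[OF h] hv)
    qed
    have z1: "2 * e * h v (P x) + h (P x) (P x) = 0" "- (2 * e * h v (P x)) + h (P x) (P x) = 0"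
      using z[of e] z[of "- e"] by simp_all
    have "2 * h (P x) (P x) = (2 * e * h v (P x) + h (P x) (P x)) + (- (2 * e * h v (P x)) + h (P x) (P x))"
      by simp
    hence hP: "h (P x) (P x) = 0" unfolding z1 by simp
    hence "e * h v (P x) = 0" using z1 by simp
    hence "e\<^sup>2 * \<beta> * h v (P x) = 0" by auto
    thus ?thesis using hP e2 by auto
  qed
  have hP: "sym_form (\<lambda>x y. h (P x) (P y))" and bP2: "sym_form (\<lambda>x y. b (P x) (P y))"
    unfolding P_def by (intro sym_form_project h b t)+
  have K: "linear_fun (\<lambda>x. h v (P x))"
    unfolding P_def by (intro linear_fun_project t sym_formD(1)[OF h])
  obtain c where c: "\<And>x. h (P x) (P x) = c * a x x"
    using form_multiple[OF a hP bl irr bnz] key by blast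
  show ?thesis
  proof (cases "\<forall>x. h v (P x) = 0")
    case True
    have "g x x = c * a x x + (g v v / \<beta>) * b x x" for x
    proof -
      have "h x x = c * a x x"
        using sym_form_expand[OF h, of "t x" v "P x"] Px[of x] True hv c by simp
      thus ?thesis by (simp add: h_def algebra_simps)
    qed
    thus ?thesis by (rule trichotomy_span)
  next
    case False
    obtain d where d: "\<And>x. b (P x) (P x) = d * a x x"
      using form_multiple[OF a bP2 K irr False] key by (metis mult_eq_0_iff)
    have "- d * a x x + 1 * b x x = (csqrt \<beta> * t x)\<^sup>2" for x
      using sym_form_expand[OF b, of "t x" v "P x"] Px[of x] bP[of x] d[of x]
      by (simp add: power_mult_distrib \<beta>_def mult.commute)
    thus ?thesis
      by (intro trichotomy_square[of "- d" 1 "\<lambda>x. csqrt \<beta> * t x"] linear_fun_mult t) auto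
  qed
qed

text \<open>
  Moving a zero \<open>x\<close> of \<open>a\<close> with \<open>M x \<noteq> 0\<close> along \<open>v\<close> to a zero of \<open>b\<close> gives \<open>g M - b L = 0\<close> at \<open>x\<close>, so
  \<open>g M - b L = a k\<close> by \<open>cubic_division\<close>. If \<open>L = c M\<close>, then \<open>g - c b\<close> is a multiple of \<open>a\<close>. Otherwise
  \<open>b L = - a k\<close> on the hyperplane \<open>M = 0\<close>, where \<open>L\<close> is not zero. If \<open>a\<close> stays irreducible there, it
  divides \<open>b\<close>, so \<open>b - c a\<close> is divisible by \<open>M\<close> for some \<open>c\<close> and the pencil has a reducible member.
  If \<open>a = l m\<close> there, then on \<open>l = 0\<close> either \<open>b\<close> vanishes, which gives the subspace \<open>M = l = 0\<close>, or \<open>L\<close>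
  does, and the same holds for \<open>m\<close>. In the remaining case \<open>l\<close> and \<open>m\<close> are proportional to \<open>L\<close>;
  cancelling \<open>L\<close> shows that \<open>a\<close> and \<open>b\<close> vanish on \<open>M = L = 0\<close>.
\<close>

lemma trichotomy_vertex_inside:
  fixes a b g :: "complex ^ 'n \<Rightarrow> complex ^ 'n \<Rightarrow> complex"
  assumes a: "sym_form a" and b: "sym_form b" and g: "sym_form g"
    and van: "\<And>x. a x x = 0 \<Longrightarrow> b x x = 0 \<Longrightarrow> g x x = 0"
    and irr: "\<not> reducible a" and rad: "\<And>x. a v x = 0" and bv: "b v v = 0"
    and nz: "\<not> (\<forall>x. b v x = 0)"
  shows "trichotomy a b g"
proof (rule ccontr)
  assume neg: "\<not> trichotomy a b g"
  define M where "M = b v"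
  define L where "L = g v"
  have M: "linear_fun M" and L: "linear_fun L"
    unfolding M_def L_def by (intro sym_formD(1) b g)+
  have Mnz: "\<not> (\<forall>x. M x = 0)" using nz by (simp add: M_def)
  have gv: "g v v = 0" using van rad bv by blast
  have cub: "g x x * M x - b x x * L x = 0" if ax: "a x x = 0" and Mx: "M x \<noteq> 0" for x
  proof -
    let ?t = "- b x x / (2 * M x)"
    let ?w = "?t *s v + x"
    have "a ?w ?w = 0" unfolding sym_form_expand[OF a] by (simp add: rad ax)
    moreover have "b ?w ?w = 0" unfolding sym_form_expand[OF b] using Mx by (simp add: bv M_def)
    ultimately have "g ?w ?w = 0" by (rule van)
    hence "2 * ?t * L x + g x x = 0" unfolding sym_form_expand[OF g] by (simp add: gv L_def)
    thus ?thesis using Mx by (simp add: field_simps)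
  qed
  obtain k where k: "linear_fun k" and gk: "\<And>x. g x x * M x - b x x * L x = a x x * k x"
    using cubic_division[OF a b g L M irr Mnz cub] by blast
  have "\<exists>p. M p = 0 \<and> L p \<noteq> 0"
  proof (rule ccontr)
    assume "\<not> ?thesis"
    then obtain c where c: "\<And>x. L x = c * M x" using linear_multiple[OF L M] by blast
    have "g x x - c * b x x = 0" if "a x x = 0" "M x \<noteq> 0" for x
      using cub[OF that] that(2) by (simp add: c algebra_simps)
    then obtain d where "\<And>x. g x x - c * b x x = d * a x x"
      using form_multiple[OF a sym_form_diff[OF g b, of c] M irr Mnz] by blast
    hence "g x x = d * a x x + c * b x x" for x by (simp add: algebra_simps)
    thus False using neg trichotomy_span by blast
  qed
  then obtain p where p: "M p = 0" "L p \<noteq> 0" by blast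
  have on_M: "b x x * L x = - (a x x * k x)" if "M x = 0" for x
    using gk[of x] that by (simp add: minus_equation_iff)
  obtain u where u: "M u = 1" using exists_normalized[OF M Mnz] by blast
  define P where "P = (\<lambda>x. x - M x *s u)"
  have MP: "M (P x) = 0" for x by (simp add: P_def linear_fun_simps[OF M] u)
  have P: "P x = x" if "M x = 0" for x using that by (simp add: P_def)
  have aP: "sym_form (\<lambda>x y. a (P x) (P y))" and bP: "sym_form (\<lambda>x y. b (P x) (P y))"
    unfolding P_def by (intro sym_form_project a b M)+
  have LP: "linear_fun (\<lambda>x. L (P x))" unfolding P_def by (intro linear_fun_project L M)
  have LPnz: "\<not> (\<forall>x. L (P x) = 0)" using p P by metis
  show False
  proof (cases "reducible (\<lambda>x y. a (P x) (P y))")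
    case False
    have "b (P x) (P x) = 0" if "a (P x) (P x) = 0" "L (P x) \<noteq> 0" for x
      using on_M[OF MP, of x] that by simp
    then obtain c where c: "\<And>x. b (P x) (P x) = c * a (P x) (P x)"
      using form_multiple[OF aP bP LP False LPnz] by blast
    define b' where "b' = (\<lambda>x y. b x y - c * a x y)"
    have b': "sym_form b'" unfolding b'_def by (intro sym_form_diff a b)
    have "b' x x = 0" if "M x = 0" for x using c[of x] P[OF that] by (simp add: b'_def)
    hence "reducible b'"
      using form_divisible_by_linear[OF b' M Mnz] M unfolding reducible_def by blast
    moreover have "g x x = 0" if "b' x x = 0" "a x x = 0" for x
      using that by (intro van) (auto simp: b'_def)
    ultimately have "trichotomy b' a g" by (intro trichotomy_reducible b' a g)
    hence "trichotomy a b g"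
      by (rule trichotomy_change_basis[of b' "- c" a 1 b a 1 0, rotated 3]) (auto simp: b'_def)
    thus False using neg by blast
  next
    case True
    then obtain l m where l: "linear_fun l" and m: "linear_fun m"
      and lm: "\<And>x. a (P x) (P x) = l x * m x"
      unfolding reducible_def by blast
    have alm: "a x x = l x * m x" if "M x = 0" for x using lm[of x] P[OF that] by simp
    have L_multiple: "\<exists>c. c \<noteq> 0 \<and> (\<forall>x. M x = 0 \<longrightarrow> L x = c * l x)"
      if l: "linear_fun l" and la: "\<And>x. M x = 0 \<Longrightarrow> l x = 0 \<Longrightarrow> a x x = 0" for l
    proof -
      let ?S = "{x. M x = 0 \<and> l x = 0}"
      have "(\<forall>x\<in>?S. b x x = 0) \<or> (\<forall>x\<in>?S. L x = 0)"
      proof (rule line_polynomial_product_zero_on)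
        show "x + t *s (y - x) \<in> ?S" if "x \<in> ?S" "y \<in> ?S" for x y t
          using that by (simp add: linear_fun_simps[OF M] linear_fun_simps[OF l])
        show "b x x * L x = 0" if "x \<in> ?S" for x
          using that on_M[of x] la[of x] by simp
      qed (intro line_polynomial_linear L line_polynomial_form b)+
      moreover have "\<not> (\<forall>x\<in>?S. b x x = 0)"
        using trichotomy_linear[OF M l, of a b g] la neg by blast
      ultimately have "\<forall>x\<in>?S. L x = 0" by blast
      hence "L (P x) = 0" if "l (P x) = 0" for x using that MP by simp
      moreover have "linear_fun (\<lambda>x. l (P x))" unfolding P_def by (intro linear_fun_project l M)
      ultimately obtain c where "\<And>x. L (P x) = c * l (P x)"
        using linear_multiple[OF LP, of "\<lambda>x. l (P x)"] by blast
      hence "\<And>x. M x = 0 \<Longrightarrow> L x = c * l x" using P by metis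
      thus ?thesis using p by (intro exI[of _ c]) auto
    qed
    obtain c where c: "c \<noteq> 0" "\<And>x. M x = 0 \<Longrightarrow> L x = c * l x"
      using L_multiple[OF l] alm by auto
    obtain d where d: "d \<noteq> 0" "\<And>x. M x = 0 \<Longrightarrow> L x = d * m x"
      using L_multiple[OF m] alm by auto
    have aL: "c * d * a x x = L x * L x" if "M x = 0" for x
      using c(2)[OF that] d(2)[OF that] alm[OF that] by (metis mult.assoc mult.left_commute)
    let ?S = "{x. M x = 0}"
    have "(\<forall>x\<in>?S. L x = 0) \<or> (\<forall>x\<in>?S. c * d * b x x + L x * k x = 0)"
    proof (rule line_polynomial_product_zero_on)
      show "x + t *s (y - x) \<in> ?S" if "x \<in> ?S" "y \<in> ?S" for x y t
        using that by (simp add: linear_fun_simps[OF M])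
      show "L x * (c * d * b x x + L x * k x) = 0" if "x \<in> ?S" for x
      proof -
        have Mx: "M x = 0" using that by simp
        have "L x * (c * d * b x x + L x * k x) = c * d * (b x x * L x) + L x * L x * k x"
          by (simp add: algebra_simps)
        also have "\<dots> = 0" unfolding on_M[OF Mx] aL[OF Mx, symmetric] by simp
        finally show ?thesis .
      qed
    qed (intro line_polynomial_intros line_polynomial_linear L k line_polynomial_form b)+
    hence "c * d * b x x + L x * k x = 0" if "M x = 0" for x using that p by auto
    hence "a x x = 0 \<and> b x x = 0" if "M x = 0" "L x = 0" for x
      using aL[of x] that c(1) d(1) by fastforce
    thus False using trichotomy_linear[OF M L] neg by blast
  qed
qed

section \<open>A singular member outside the common radical\<close>

lemma linear_fun_sum: "linear_fun l \<Longrightarrow> l (sum f A) = (\<Sum>i\<in>A. l (f i))"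
  by (induction A rule: infinite_finite_induct) (auto simp: linear_fun_simps)

lemma linear_fun_expand:
  fixes l :: "complex ^ 'n::finite \<Rightarrow> complex"
  assumes l: "linear_fun l"
  shows "l x = (\<Sum>i\<in>UNIV. x $ i * l (axis i 1))"
proof -
  have "l x = l (\<Sum>i\<in>UNIV. x $ i *s axis i 1)" by (simp add: basis_expansion)
  also have "\<dots> = (\<Sum>i\<in>UNIV. x $ i * l (axis i 1))"
    by (simp add: linear_fun_sum[OF l] linear_fun_simps[OF l])
  finally show ?thesis .
qed

lemma separating_functional:
  fixes S :: "(complex ^ 'n::finite) set"
  assumes S: "vec.subspace S" and u: "u \<notin> S"
  shows "\<exists>l. linear_fun l \<and> (\<forall>x\<in>S. l x = 0) \<and> l u \<noteq> 0"
proof -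
  obtain B where B: "B \<subseteq> S" "vec.independent B" "S \<subseteq> vec.span B"
    using vec.maximal_independent_subset by blast
  have "u \<notin> vec.span B" using u vec.span_minimal[OF B(1) S] by blast
  hence "vec.independent (insert u B)" using B(2) by (simp add: vec.independent_insertI)
  then obtain g where g: "Vector_Spaces.linear (*s) (*s) g"
    and gB: "\<And>x. x \<in> insert u B \<Longrightarrow> g x = (if x = u then u else 0)"
    using vec.linear_independent_extend[of "insert u B" "\<lambda>x. if x = u then u else 0"] by blast
  interpret g: Vector_Spaces.linear "(*s)" "(*s)" g by (rule g)
  have "u \<noteq> 0" using u vec.subspace_0[OF S] by blast
  then obtain i where i: "u $ i \<noteq> 0" by (auto simp: vec_eq_iff)
  have l: "linear_fun (\<lambda>x. g x $ i)"
    by (simp add: linear_fun_def g.add g.scale)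
  have "g x = 0" if "x \<in> S" for x
  proof (rule g.eq_0_on_span)
    show "x \<in> vec.span B" using that B(3) by blast
    show "g y = 0" if "y \<in> B" for y
      using gB[of y] that B(1) u by auto
  qed
  thus ?thesis using l i gB[of u] by (intro exI[of _ "\<lambda>x. g x $ i"]) auto
qed

text \<open>
  The image of \<open>x \<mapsto> a x\<close> is the annihilator of the kernel, by symmetry of \<open>a\<close>: a functional that
  separates the vector of \<open>b w\<close> from the image is evaluation at some \<open>r\<close> in the kernel of \<open>a\<close>, hence
  of \<open>b\<close>.
\<close>

lemma form_range:
  fixes a b :: "complex ^ 'n::finite \<Rightarrow> complex ^ 'n \<Rightarrow> complex"
  assumes a: "sym_form a" and b: "sym_form b"
    and ker: "\<And>v. (\<forall>y. a v y = 0) \<Longrightarrow> (\<forall>y. b v y = 0)"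
  shows "\<exists>x. \<forall>y. a x y = b w y"
proof -
  define A :: "complex ^ 'n \<Rightarrow> complex ^ 'n" where "A = (\<lambda>x. \<chi> i. a x (axis i 1))"
  define u :: "complex ^ 'n" where "u = (\<chi> i. b w (axis i 1))"
  have S: "vec.subspace (range A)"
    unfolding vec.subspace_def
  proof (intro conjI ballI allI)
    have "A 0 = 0" by (simp add: A_def vec_eq_iff sym_form_simps[OF a])
    thus "0 \<in> range A" by (metis rangeI)
  next
    fix x y assume "x \<in> range A" "y \<in> range A"
    then obtain p q where "x = A p" "y = A q" by blast
    hence "x + y = A (p + q)" by (simp add: A_def vec_eq_iff sym_form_simps[OF a])
    thus "x + y \<in> range A" by blast
  next
    fix c x assume "x \<in> range A"
    then obtain p where "x = A p" by blast
    hence "c *s x = A (c *s p)" by (simp add: A_def vec_eq_iff sym_form_simps[OF a])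
    thus "c *s x \<in> range A" by blast
  qed
  have "u \<in> range A"
  proof (rule ccontr)
    assume "u \<notin> range A"
    from separating_functional[OF S this] obtain l
      where l: "linear_fun l" and lA: "\<And>x. l (A x) = 0" and lu: "l u \<noteq> 0" by blast
    define r :: "complex ^ 'n" where "r = (\<chi> i. l (axis i 1))"
    have "a r x = 0" for x
    proof -
      have "a r x = a x r" by (rule sym_formD(2)[OF a])
      also have "\<dots> = l (A x)"
        using linear_fun_expand[OF sym_formD(1)[OF a], of x r] linear_fun_expand[OF l, of "A x"]
        by (simp add: A_def r_def mult.commute)
      finally show ?thesis using lA by simp
    qed
    hence "b r w = 0" using ker by blast
    moreover have "b r w = b w r" by (rule sym_formD(2)[OF b])
    moreover have "b w r = l u"
      using linear_fun_expand[OF sym_formD(1)[OF b], of w r] linear_fun_expand[OF l, of u]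
      by (simp add: u_def r_def mult.commute)
    ultimately show False using lu by simp
  qed
  then obtain x where "u = A x" by blast
  hence "a x (axis i 1) = b w (axis i 1)" for i by (simp add: u_def A_def vec_eq_iff)
  hence "a x y = b w y" for y
    using linear_fun_expand[OF sym_formD(1)[OF a], of x y]
      linear_fun_expand[OF sym_formD(1)[OF b], of w y] by simp
  thus ?thesis by blast
qed

text \<open>
  The first \<open>n + 1\<close> vectors form a dependent set, or two of them coincide; a coincidence is itself a
  relation.
\<close>

lemma sequence_relation:
  fixes w :: "nat \<Rightarrow> complex ^ 'n::finite"
  shows "\<exists>p. p \<noteq> 0 \<and> (\<Sum>i\<le>degree p. coeff p i *s w i) = 0"
proof -
  let ?n = "CARD('n)"
  obtain c where c: "(\<Sum>i\<le>?n. c i *s w i) = 0" "\<exists>i\<le>?n. c i \<noteq> 0"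
  proof (cases "inj_on w {..?n}")
    case True
    have "card (w ` {..?n}) > vec.dim (w ` {..?n})"
      using vec.dim_subset_UNIV[of "w ` {..?n}"] card_image[OF True]
      by (simp add: vec.dimension_def card_cart_basis)
    hence "vec.dependent (w ` {..?n})"
      using vec.dim_eq_card_independent by (metis less_irrefl)
    then obtain u where u: "\<exists>x\<in>w ` {..?n}. u x \<noteq> 0" "(\<Sum>x\<in>w ` {..?n}. u x *s x) = 0"
      using vec.dependent_finite[of "w ` {..?n}"] by auto
    show ?thesis
      using u(1) u(2) sum.reindex[OF True, of "\<lambda>x. u x *s x"]
      by (intro that[of "\<lambda>i. u (w i)"]) (auto simp: o_def)
  next
    case False
    then obtain i j where ij: "i \<le> ?n" "j \<le> ?n" "i \<noteq> j" "w i = w j" by (auto simp: inj_on_def)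
    let ?c = "\<lambda>k. (if k = i then 1 else 0) - (if k = j then 1 else 0 :: complex)"
    have "(\<Sum>k\<le>?n. ?c k *s w k) = (\<Sum>k\<le>?n. if k = i then w i else 0) - (\<Sum>k\<le>?n. if k = j then w j else 0)"
      unfolding sum_subtractf[symmetric]
      by (rule sum.cong) (auto simp: vector_sub_rdistrib vec_eq_iff)
    also have "\<dots> = 0" using ij by (simp add: sum.delta)
    finally show ?thesis using ij by (intro that[of ?c]) auto
  qed
  define p where "p = (\<Sum>i\<le>?n. monom (c i) i)"
  have cp: "coeff p i = (if i \<le> ?n then c i else 0)" for i
    unfolding p_def coeff_sum coeff_monom by (simp add: sum.delta')
  have p0: "p \<noteq> 0" using c(2) cp by (metis coeff_0)
  have "degree p \<le> ?n" using cp by (intro degree_le) auto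
  hence "(\<Sum>i\<le>degree p. coeff p i *s w i) = (\<Sum>i\<le>?n. coeff p i *s w i)"
    by (intro sum.mono_neutral_left) (auto simp: coeff_eq_0)
  also have "\<dots> = 0" using c(1) by (simp add: cp)
  finally have "(\<Sum>i\<le>degree p. coeff p i *s w i) = 0" .
  thus ?thesis using p0 by blast
qed

text \<open>
  If the kernel of \<open>a\<close> lies in that of \<open>b\<close>, there is a map \<open>T\<close> with \<open>a (T w) = b w\<close>, and an eigenvector
  of \<open>T\<close> modulo the kernel of \<open>a\<close>, for the eigenvalue \<open>z\<close>, is the required vector for \<open>b - z a\<close>. It is
  found as for a single endomorphism: take a nonzero polynomial \<open>p\<close> of least degree for which the
  combination \<open>V p\<close> of the iterates of a vector outside the kernel lies in the kernel, and divide it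
  by a linear factor. The vectors \<open>T w\<close> are determined modulo the kernel, and linear in \<open>w\<close> modulo it,
  so any choice function serves as \<open>T\<close>.
\<close>

lemma pencil_vertex:
  fixes a b :: "complex ^ 'n::finite \<Rightarrow> complex ^ 'n \<Rightarrow> complex"
  assumes a: "sym_form a" and b: "sym_form b" and nz: "\<not> (\<forall>x y. a x y = 0 \<and> b x y = 0)"
  shows "\<exists>\<alpha> \<beta> v. \<not> (\<alpha> = 0 \<and> \<beta> = 0) \<and> (\<forall>y. \<alpha> * a v y + \<beta> * b v y = 0)
    \<and> \<not> (\<forall>y. a v y = 0 \<and> b v y = 0)"
proof (cases "\<exists>v. (\<forall>y. a v y = 0) \<and> \<not> (\<forall>y. b v y = 0)")
  case True
  then obtain v where "\<forall>y. a v y = 0" "\<not> (\<forall>y. b v y = 0)" by blast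
  thus ?thesis by (intro exI[of _ 1] exI[of _ 0] exI[of _ v]) auto
next
  case False
  hence ker: "\<And>v. (\<forall>y. a v y = 0) \<Longrightarrow> (\<forall>y. b v y = 0)" by blast
  then obtain w\<^sub>0 where w0: "\<not> (\<forall>y. a w\<^sub>0 y = 0)" using nz by blast
  define T where "T = (\<lambda>w. SOME x. \<forall>y. a x y = b w y)"
  have T: "a (T w) y = b w y" for w y
    unfolding T_def using someI_ex[OF form_range[OF a b ker, of w]] by blast
  define w where "w = (\<lambda>i. (T ^^ i) w\<^sub>0)"
  have wS: "a (w (Suc i)) y = b (w i) y" for i y by (simp add: w_def T)
  define V where "V = (\<lambda>p. \<Sum>i\<le>degree p. coeff p i *s w i)"
  have form_V: "f (V p) y = (\<Sum>i\<le>degree p. coeff p i * f (w i) y)" if f: "sym_form f"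
    for f :: "complex ^ 'n \<Rightarrow> complex ^ 'n \<Rightarrow> complex" and p y
    using linear_fun_sum[OF sym_form_left[OF f, of y], of "\<lambda>i. coeff p i *s w i" "{..degree p}"]
    by (simp add: V_def sym_form_simps(3)[OF f])
  define R where "R = (\<lambda>p. p \<noteq> 0 \<and> (\<forall>y. a (V p) y = 0))"
  obtain p0 where "R p0"
  proof -
    obtain p where "p \<noteq> 0" "V p = 0" using sequence_relation[of w] unfolding V_def by blast
    thus ?thesis by (intro that[of p]) (simp add: R_def sym_form_simps(7)[OF a])
  qed
  then obtain p where p: "R p" and min: "\<And>q. R q \<Longrightarrow> degree p \<le> degree q"
    using ex_has_least_nat[of R p0 degree] by blast
  have "degree p \<noteq> 0"
  proof
    assume d: "degree p = 0"
    hence "coeff p 0 \<noteq> 0" using p unfolding R_def by (metis leading_coeff_0_iff)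
    moreover have "coeff p 0 * a w\<^sub>0 y = 0" for y
      using p d form_V[OF a, of p y] by (simp add: R_def w_def)
    ultimately show False using w0 by simp
  qed
  hence "\<not> constant (poly p)" by (simp add: constant_degree)
  then obtain z where "poly p z = 0" using fundamental_theorem_of_algebra by blast
  then obtain q where pq: "p = [:- z, 1:] * q" by (auto simp: poly_eq_0_iff_dvd elim: dvdE)
  have q0: "q \<noteq> 0" using p pq by (auto simp: R_def)
  have deg: "degree p = Suc (degree q)"
    unfolding pq using q0 by (subst degree_mult_eq) auto
  have "\<not> R q" using min[of q] deg by auto
  hence nq: "\<not> (\<forall>y. a (V q) y = 0)" using q0 by (simp add: R_def)
  have "- z * a (V q) y + 1 * b (V q) y = 0" for y
  proof -
    have cz: "coeff p 0 = - z * coeff q 0" unfolding pq by simp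
    have cs: "coeff p (Suc i) = coeff q i - z * coeff q (Suc i)" for i unfolding pq by simp
    have ext: "(\<Sum>i\<le>degree q. coeff q (Suc i) * a (w (Suc i)) y)
        = (\<Sum>i\<le>degree q. coeff q i * a (w i) y) - coeff q 0 * a (w 0) y"
      using sum.atMost_Suc_shift[of "\<lambda>i. coeff q i * a (w i) y" "degree q"]
        sum.atMost_Suc[of "\<lambda>i. coeff q i * a (w i) y" "degree q"]
      by (simp add: coeff_eq_0)
    have "0 = a (V p) y" using p by (simp add: R_def)
    also have "\<dots> = coeff p 0 * a (w 0) y + (\<Sum>i\<le>degree q. coeff p (Suc i) * a (w (Suc i)) y)"
      unfolding form_V[OF a] deg by (rule sum.atMost_Suc_shift)
    also have "\<dots> = - z * coeff q 0 * a (w 0) y + ((\<Sum>i\<le>degree q. coeff q i * b (w i) y)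
        - z * (\<Sum>i\<le>degree q. coeff q (Suc i) * a (w (Suc i)) y))"
      unfolding cz cs by (simp add: wS[symmetric] left_diff_distrib sum_subtractf sum_distrib_left mult.assoc)
    also have "\<dots> = - z * a (V q) y + 1 * b (V q) y"
      unfolding ext form_V[OF a] form_V[OF b] by (simp add: algebra_simps)
    finally show ?thesis by simp
  qed
  thus ?thesis using nq by (intro exI[of _ "- z"] exI[of _ 1] exI[of _ "V q"]) auto
qed

text \<open>
  The pencil member that is singular at \<open>v\<close> becomes the first basis vector. The second one is \<open>a\<close> or
  \<open>b\<close>, and it is nonzero at \<open>v\<close> because \<open>v\<close> is outside the common radical.
\<close>

theorem trichotomy_forms:
  fixes a b g :: "complex ^ 'n::finite \<Rightarrow> complex ^ 'n \<Rightarrow> complex"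
  assumes a: "sym_form a" and b: "sym_form b" and g: "sym_form g"
    and van: "\<And>x. a x x = 0 \<Longrightarrow> b x x = 0 \<Longrightarrow> g x x = 0"
  shows "trichotomy a b g"
proof (cases "\<forall>x y. a x y = 0 \<and> b x y = 0")
  case True
  thus ?thesis by (intro trichotomy_square[of 1 0 "\<lambda>x. 0"] linear_fun_zero) auto
next
  case False
  have core: "trichotomy a b g"
    if a: "sym_form a" and b: "sym_form b" and van: "\<And>x. a x x = 0 \<Longrightarrow> b x x = 0 \<Longrightarrow> g x x = 0"
      and rad: "\<And>y. a v y = 0" and nz: "\<not> (\<forall>y. b v y = 0)"
    for a b v
    using trichotomy_reducible[OF a b g _ van] trichotomy_vertex_outside[OF a b g van _ rad]
      trichotomy_vertex_inside[OF a b g van _ rad _ nz] by blast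
  obtain \<alpha> \<beta> v where nz: "\<not> (\<alpha> = 0 \<and> \<beta> = 0)" and rad: "\<And>y. \<alpha> * a v y + \<beta> * b v y = 0"
    and v: "\<not> (\<forall>y. a v y = 0 \<and> b v y = 0)"
    using pencil_vertex[OF a b False] by blast
  show ?thesis
  proof (cases "\<beta> = 0")
    case True
    hence "\<And>y. a v y = 0" using nz rad by simp
    thus ?thesis using core[OF a b van, of v] v by blast
  next
    case False
    define c where "c = (\<lambda>x y. \<alpha> * a x y + \<beta> * b x y)"
    have c: "sym_form c" unfolding c_def by (rule sym_form_lincomb[OF a b])
    have cv: "\<And>y. c v y = 0" using rad by (simp add: c_def)
    have av: "\<not> (\<forall>y. a v y = 0)" using v rad False by (metis add_0 mult_eq_0_iff)
    have "g x x = 0" if "c x x = 0" "a x x = 0" for x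
      using that False by (intro van) (auto simp: c_def)
    hence "trichotomy c a g" by (rule core[OF c a _ cv av])
    thus ?thesis
      by (rule trichotomy_change_basis[of c \<alpha> a \<beta> b a 1 0, rotated 3])
        (use False in \<open>auto simp: c_def\<close>)
  qed
qed

section \<open>Polynomials and their functions\<close>

definition eval_monomial :: "('n::finite \<Rightarrow>\<^sub>0 nat) \<Rightarrow> complex ^ 'n \<Rightarrow> complex" where
  "eval_monomial m p = (\<Prod>i\<in>UNIV. p $ i ^ Poly_Mapping.lookup m i)"

lemma eval_poly_superset:
  assumes "finite K" "Poly_Mapping.keys P \<subseteq> K"
  shows "eval_poly P p = (\<Sum>m\<in>K. Poly_Mapping.lookup P m * eval_monomial m p)"
  unfolding eval_poly_def eval_monomial_def
  using assms by (intro sum.mono_neutral_left) (auto simp: in_keys_iff)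

lemma eval_poly_zero: "eval_poly 0 p = 0"
  by (simp add: eval_poly_def)

lemma eval_poly_add: "eval_poly (P + Q) p = eval_poly P p + eval_poly Q p"
proof -
  let ?K = "Poly_Mapping.keys P \<union> Poly_Mapping.keys Q"
  show ?thesis
    using eval_poly_superset[of ?K P p] eval_poly_superset[of ?K Q p]
      eval_poly_superset[of ?K "P + Q" p] Poly_Mapping.keys_add[of P Q]
    by (simp add: lookup_add sum.distrib distrib_right)
qed

lemma eval_poly_diff: "eval_poly (P - Q) p = eval_poly P p - eval_poly Q p"
  using eval_poly_add[of "P - Q" Q p] by simp

lemma eval_poly_sum: "eval_poly (sum f A) p = (\<Sum>i\<in>A. eval_poly (f i) p)"
  by (induction A rule: infinite_finite_induct) (auto simp: eval_poly_zero eval_poly_add)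

lemma eval_poly_single: "eval_poly (Poly_Mapping.single m c) p = c * eval_monomial m p"
  using eval_poly_superset[of "{m}" "Poly_Mapping.single m c" p] by (simp add: keys_single)

lemma poly_mapping_eq_sum_single:
  "P = (\<Sum>m\<in>Poly_Mapping.keys P. Poly_Mapping.single m (Poly_Mapping.lookup P m))"
proof (rule poly_mapping_eqI)
  fix k
  have "(\<Sum>m\<in>Poly_Mapping.keys P. Poly_Mapping.lookup (Poly_Mapping.single m (Poly_Mapping.lookup P m)) k)
      = (\<Sum>m\<in>Poly_Mapping.keys P. if m = k then Poly_Mapping.lookup P m else 0)"
    by (rule sum.cong) (auto simp: lookup_single when_def)
  also have "\<dots> = Poly_Mapping.lookup P k" by (simp add: in_keys_iff)
  finally show "Poly_Mapping.lookup P k = Poly_Mapping.lookup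
      (\<Sum>m\<in>Poly_Mapping.keys P. Poly_Mapping.single m (Poly_Mapping.lookup P m)) k"
    by (simp add: lookup_sum)
qed

lemma eval_monomial_add: "eval_monomial (m + k) p = eval_monomial m p * eval_monomial k p"
  by (simp add: eval_monomial_def lookup_add power_add prod.distrib)

lemma eval_monomial_zero: "eval_monomial 0 p = 1"
  by (simp add: eval_monomial_def)

lemma eval_monomial_var: "eval_monomial (Poly_Mapping.single i 1) p = p $ i"
proof -
  have "eval_monomial (Poly_Mapping.single i 1) p = (\<Prod>j\<in>UNIV. if j = i then p $ j else 1)"
    unfolding eval_monomial_def by (rule prod.cong) (auto simp: lookup_single when_def)
  thus ?thesis by simp
qed

lemma eval_poly_mult: "eval_poly (P * Q) p = eval_poly P p * eval_poly Q p"
proof -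
  have "P * Q = (\<Sum>m\<in>Poly_Mapping.keys P. \<Sum>k\<in>Poly_Mapping.keys Q.
      Poly_Mapping.single (m + k) (Poly_Mapping.lookup P m * Poly_Mapping.lookup Q k))"
    by (subst poly_mapping_eq_sum_single[of P], subst poly_mapping_eq_sum_single[of Q])
       (simp add: sum_product mult_single)
  hence "eval_poly (P * Q) p = (\<Sum>m\<in>Poly_Mapping.keys P. \<Sum>k\<in>Poly_Mapping.keys Q.
      (Poly_Mapping.lookup P m * Poly_Mapping.lookup Q k) * (eval_monomial m p * eval_monomial k p))"
    by (simp add: eval_poly_sum eval_poly_single eval_monomial_add)
  also have "\<dots> = eval_poly P p * eval_poly Q p"
    unfolding eval_poly_def eval_monomial_def[symmetric] sum_product
    by (intro sum.cong refl) (simp add: mult_ac)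
  finally show ?thesis .
qed

lemma eval_poly_const: "eval_poly (const_poly c) p = c"
  by (simp add: const_poly_def eval_poly_single eval_monomial_zero)

lemma homogeneous_add: "homogeneous d P \<Longrightarrow> homogeneous d Q \<Longrightarrow> homogeneous d (P + Q)"
  using Poly_Mapping.keys_add[of P Q] unfolding homogeneous_def by blast

lemma homogeneous_diff: "homogeneous d P \<Longrightarrow> homogeneous d Q \<Longrightarrow> homogeneous d (P - Q)"
  using keys_diff[of P Q] unfolding homogeneous_def by blast

lemma homogeneous_sum: "(\<And>i. i \<in> A \<Longrightarrow> homogeneous d (f i)) \<Longrightarrow> homogeneous d (sum f A)"
  by (induction A rule: infinite_finite_induct) (auto intro!: homogeneous_add, auto simp: homogeneous_def)

lemma homogeneous_mult:
  assumes "homogeneous d P" "homogeneous e Q"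
  shows "homogeneous (d + e) (P * Q)"
  unfolding homogeneous_def
proof
  fix m assume "m \<in> Poly_Mapping.keys (P * Q)"
  then obtain k l where "m = k + l" "k \<in> Poly_Mapping.keys P" "l \<in> Poly_Mapping.keys Q"
    using keys_mult[of P Q] by blast
  thus "(\<Sum>i\<in>UNIV. Poly_Mapping.lookup m i) = d + e"
    using assms by (simp add: homogeneous_def lookup_add sum.distrib)
qed

lemma homogeneous_const: "homogeneous 0 (const_poly c)"
  by (simp add: homogeneous_def const_poly_def keys_single)

lemma homogeneous_scale: "homogeneous d P \<Longrightarrow> homogeneous d (const_poly c * P)"
  using homogeneous_mult[OF homogeneous_const] by simp

lemma homogeneous_var: "homogeneous 1 (Poly_Mapping.single (Poly_Mapping.single i 1) c)"
  by (auto simp: homogeneous_def keys_single lookup_single when_def)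

lemma monomial_split_var:
  fixes m :: "'n::finite \<Rightarrow>\<^sub>0 nat"
  assumes "(\<Sum>i\<in>UNIV. Poly_Mapping.lookup m i) = Suc d"
  obtains i k where "m = Poly_Mapping.single i 1 + k" "(\<Sum>i\<in>UNIV. Poly_Mapping.lookup k i) = d"
proof -
  obtain i where i: "Poly_Mapping.lookup m i \<noteq> 0"
    using assms by (metis sum.neutral nat.simps(3))
  define k where "k = m - Poly_Mapping.single i 1"
  have m: "m = Poly_Mapping.single i 1 + k"
    unfolding k_def by (rule poly_mapping_eqI)
      (use i in \<open>auto simp: lookup_add lookup_minus lookup_single when_def\<close>)
  have "(\<Sum>j\<in>UNIV. Poly_Mapping.lookup (Poly_Mapping.single i (1::nat)) j) = 1"
    by (simp add: lookup_single when_def)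
  hence "(\<Sum>i\<in>UNIV. Poly_Mapping.lookup k i) = d"
    using assms unfolding m lookup_add sum.distrib by simp
  thus ?thesis using m that by blast
qed

lemma quadratic_monomial:
  fixes m :: "'n::finite \<Rightarrow>\<^sub>0 nat"
  assumes "(\<Sum>i\<in>UNIV. Poly_Mapping.lookup m i) = 2"
  obtains i j where "m = Poly_Mapping.single i 1 + Poly_Mapping.single j 1"
proof -
  obtain i k where ik: "m = Poly_Mapping.single i 1 + k" "(\<Sum>i\<in>UNIV. Poly_Mapping.lookup k i) = Suc 0"
    using assms monomial_split_var[of m 1] by (metis One_nat_def Suc_1)
  obtain j l where jl: "k = Poly_Mapping.single j 1 + l" "(\<Sum>i\<in>UNIV. Poly_Mapping.lookup l i) = 0"
    using monomial_split_var[OF ik(2)] by blast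
  have "l = 0" by (rule poly_mapping_eqI) (use jl(2) in auto)
  thus ?thesis using ik jl that by simp
qed

text \<open>
  A quadratic monomial is a product of two variables, which polarises to half the sum of the two
  mixed products.
\<close>

lemma quadratic_form_sym_form:
  fixes P :: "'n::finite cpoly"
  assumes "quadratic_form P"
  shows "\<exists>b. sym_form b \<and> (\<forall>p. eval_poly P p = b p p)"
proof -
  let ?has = "\<lambda>f :: complex ^ 'n \<Rightarrow> complex. \<exists>b. sym_form b \<and> (\<forall>p. f p = b p p)"
  have mono: "?has (\<lambda>p. c * eval_monomial m p)"
    if m: "(\<Sum>i\<in>UNIV. Poly_Mapping.lookup m i) = 2" for c and m :: "'n \<Rightarrow>\<^sub>0 nat"
  proof -
    obtain i j where ij: "m = Poly_Mapping.single i 1 + Poly_Mapping.single j 1"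
      using quadratic_monomial[OF m] by blast
    show ?thesis
      by (rule exI[of _ "\<lambda>x y. c / 2 * (x $ i * y $ j + x $ j * y $ i)"])
         (auto simp: sym_form_def linear_fun_def ij eval_monomial_add
            eval_monomial_var[unfolded One_nat_def] field_simps)
  qed
  have "?has (\<lambda>p. \<Sum>m\<in>K. Poly_Mapping.lookup P m * eval_monomial m p)"
    if "finite K" "K \<subseteq> Poly_Mapping.keys P" for K
    using that
  proof (induction K rule: finite_induct)
    case empty
    show ?case using sym_form_zero by auto
  next
    case (insert m K)
    obtain b where b: "sym_form b"
      "\<And>p. (\<Sum>m\<in>K. Poly_Mapping.lookup P m * eval_monomial m p) = b p p"
      using insert by auto
    obtain c where c: "sym_form c" "\<And>p. Poly_Mapping.lookup P m * eval_monomial m p = c p p"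
      using mono[of m "Poly_Mapping.lookup P m"] insert assms unfolding homogeneous_def by auto
    show ?case
      using sym_form_lincomb[OF b(1) c(1), of 1 1] b(2) c(2) insert
      by (intro exI[of _ "\<lambda>x y. 1 * b x y + 1 * c x y"]) simp
  qed
  from this[of "Poly_Mapping.keys P"] show ?thesis
    by (simp add: eval_poly_superset[of "Poly_Mapping.keys P" P])
qed

text \<open>
  Evaluation at the basis vectors isolates the coefficients of the squares, and evaluation at sums
  of two basis vectors those of the mixed products. In \<open>sub\<close>, \<open>K\<close> is the set of the quadratic
  monomials with value one at \<open>p\<close>, the others having value zero.
\<close>

lemma quadratic_form_eq_0I:
  fixes P :: "'n::finite cpoly"
  assumes P: "quadratic_form P" and zero: "\<And>p. eval_poly P p = 0"
  shows "P = 0"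
proof -
  define e :: "'n \<Rightarrow> 'n \<Rightarrow>\<^sub>0 nat" where "e = (\<lambda>i. Poly_Mapping.single i 1)"
  have ev_e: "eval_monomial (e i) p = p $ i" for i p
    unfolding e_def by (rule eval_monomial_var)
  have e_eq: "e i + e j = e k + e l \<longleftrightarrow> i = k \<and> j = l \<or> i = l \<and> j = k" for i j k l
  proof
    assume "e i + e j = e k + e l"
    hence "eval_monomial (e i + e j) p = eval_monomial (e k + e l) p" for p by simp
    hence eq: "p $ i * p $ j = p $ k * p $ l" for p :: "complex ^ 'n"
      by (simp add: eval_monomial_add ev_e)
    show "i = k \<and> j = l \<or> i = l \<and> j = k"
      (* Distinct primes at i and j detect which variables occur on the right. *)
      using eq[of "\<chi> r. if r = i then 2 else if r = j then 3 else 1"]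
        eq[of "\<chi> r. if r = i then 2 else 1"] by (simp split: if_splits)
  qed (auto simp: add.commute)
  have sub: "(\<Sum>m\<in>K. Poly_Mapping.lookup P m) = 0"
    if K: "finite K" and one: "\<And>k l. eval_monomial (e k + e l) p = (if e k + e l \<in> K then 1 else 0)"
    for K p
  proof -
    have "0 = (\<Sum>m\<in>Poly_Mapping.keys P. Poly_Mapping.lookup P m * eval_monomial m p)"
      using zero[of p] eval_poly_superset[of "Poly_Mapping.keys P" P p] by simp
    also have "\<dots> = (\<Sum>m\<in>Poly_Mapping.keys P. if m \<in> K then Poly_Mapping.lookup P m else 0)"
    proof (rule sum.cong)
      fix m assume "m \<in> Poly_Mapping.keys P"
      then obtain k l where "m = e k + e l"
        using P quadratic_monomial[of m] unfolding homogeneous_def e_def by metis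
      thus "Poly_Mapping.lookup P m * eval_monomial m p = (if m \<in> K then Poly_Mapping.lookup P m else 0)"
        using one by simp
    qed simp
    also have "\<dots> = (\<Sum>m\<in>Poly_Mapping.keys P \<inter> K. Poly_Mapping.lookup P m)"
      by (simp add: sum.inter_restrict)
    also have "\<dots> = (\<Sum>m\<in>K. Poly_Mapping.lookup P m)"
      using K by (intro sum.mono_neutral_left) (auto simp: in_keys_iff)
    finally show ?thesis by simp
  qed
  have diag: "Poly_Mapping.lookup P (e i + e i) = 0" for i
    using sub[of "{e i + e i}" "axis i 1"]
    by (simp add: eval_monomial_add ev_e e_eq axis_def)
  have "Poly_Mapping.lookup P (e i + e j) = 0" for i j
  proof (cases "i = j")
    case False
    have "(\<Sum>m\<in>{e i + e i, e j + e j, e i + e j}. Poly_Mapping.lookup P m) = 0"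
      by (rule sub[of _ "axis i 1 + axis j 1"])
         (use False in \<open>auto simp: eval_monomial_add ev_e e_eq axis_def\<close>)
    moreover have "e i + e i \<notin> {e j + e j, e i + e j}" "e j + e j \<notin> {e i + e j}"
      using False by (auto simp only: insert_iff empty_iff e_eq)
    ultimately show ?thesis
      by (simp only: sum.insert finite.intros sum.empty diag add_0 add_0_right
          empty_iff simp_thms)
  qed (simp add: diag)
  hence "Poly_Mapping.keys P = {}"
    using P quadratic_monomial unfolding homogeneous_def e_def by (metis in_keys_iff equals0I)
  thus ?thesis by simp
qed

lemma quadratic_form_eqI:
  assumes "quadratic_form P" "quadratic_form Q" "\<And>p. eval_poly P p = eval_poly Q p"
  shows "P = Q"
  using quadratic_form_eq_0I[OF homogeneous_diff[OF assms(1,2)]] assms(3)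
  by (simp add: eval_poly_diff)

lemma linear_fun_linear_form:
  fixes l :: "complex ^ 'n::finite \<Rightarrow> complex"
  assumes "linear_fun l"
  obtains P where "linear_form P" "\<And>p. eval_poly P p = l p"
proof
  let ?P = "\<Sum>i\<in>UNIV. Poly_Mapping.single (Poly_Mapping.single i 1) (l (axis i 1)) :: 'n cpoly"
  show "linear_form ?P" by (intro homogeneous_sum homogeneous_var)
  show "eval_poly ?P p = l p" for p
    unfolding eval_poly_sum eval_poly_single eval_monomial_var
    by (subst linear_fun_expand[OF assms]) (simp add: mult.commute)
qed

theorem theorem1p10:
  fixes Q Q1 Q2 :: "'n::finite cpoly"
  assumes "quadratic_form Q" and "quadratic_form Q1" and "quadratic_form Q2"
    and "\<And>p. eval_poly Q1 p = 0 \<Longrightarrow> eval_poly Q2 p = 0 \<Longrightarrow> eval_poly Q p = 0"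
  shows
    "(\<exists>\<alpha> \<beta>. Q = const_poly \<alpha> * Q1 + const_poly \<beta> * Q2)
     \<or> (\<exists>\<alpha> \<beta> l. \<not> (\<alpha> = 0 \<and> \<beta> = 0) \<and> linear_form l
           \<and> const_poly \<alpha> * Q1 + const_poly \<beta> * Q2 = l\<^sup>2)
     \<or> (\<exists>l1 l2. linear_form l1 \<and> linear_form l2
           \<and> (\<forall>p. eval_poly l1 p = 0 \<and> eval_poly l2 p = 0 \<longrightarrow>
                 eval_poly Q p = 0 \<and> eval_poly Q1 p = 0 \<and> eval_poly Q2 p = 0))"
proof -
  obtain g where g: "sym_form g" "\<And>p. eval_poly Q p = g p p"
    using quadratic_form_sym_form[OF assms(1)] by blast
  obtain a where a: "sym_form a" "\<And>p. eval_poly Q1 p = a p p"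
    using quadratic_form_sym_form[OF assms(2)] by blast
  obtain b where b: "sym_form b" "\<And>p. eval_poly Q2 p = b p p"
    using quadratic_form_sym_form[OF assms(3)] by blast
  have pencil: "quadratic_form (const_poly \<alpha> * Q1 + const_poly \<beta> * Q2)" for \<alpha> \<beta>
    by (intro homogeneous_add homogeneous_scale assms)
  have eval_pencil: "eval_poly (const_poly \<alpha> * Q1 + const_poly \<beta> * Q2) p = \<alpha> * a p p + \<beta> * b p p"
    for \<alpha> \<beta> p
    by (simp add: eval_poly_add eval_poly_mult eval_poly_const a b)
  have "trichotomy a b g"
    using assms(4) by (intro trichotomy_forms a b g) (simp add: a b g)
  thus ?thesis
    unfolding trichotomy_def
  proof (elim disjE exE conjE)
    fix \<alpha> \<beta> assume "\<forall>x. g x x = \<alpha> * a x x + \<beta> * b x x"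
    hence "Q = const_poly \<alpha> * Q1 + const_poly \<beta> * Q2"
      by (intro quadratic_form_eqI assms pencil) (simp only: eval_pencil g)
    thus ?thesis by blast
  next
    fix \<alpha> \<beta> l assume nz: "\<not> (\<alpha> = 0 \<and> \<beta> = 0)" and l: "linear_fun l"
      and sq: "\<forall>x. \<alpha> * a x x + \<beta> * b x x = (l x)\<^sup>2"
    obtain l' where l': "linear_form l'" "\<And>p. eval_poly l' p = l p"
      using linear_fun_linear_form[OF l] by blast
    have "quadratic_form (l'\<^sup>2)"
      using homogeneous_mult[OF l'(1) l'(1)] by (simp only: power2_eq_square one_add_one)
    hence "const_poly \<alpha> * Q1 + const_poly \<beta> * Q2 = l'\<^sup>2"
      using sq by (intro quadratic_form_eqI pencil)
        (simp_all add: eval_pencil power2_eq_square eval_poly_mult l'(2))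
    thus ?thesis using nz l'(1) by blast
  next
    fix l m assume l: "linear_fun l" and m: "linear_fun m"
      and van: "\<forall>x. l x = 0 \<and> m x = 0 \<longrightarrow> a x x = 0 \<and> b x x = 0"
    obtain l' where l': "linear_form l'" "\<And>p. eval_poly l' p = l p"
      using linear_fun_linear_form[OF l] by blast
    obtain m' where m': "linear_form m'" "\<And>p. eval_poly m' p = m p"
      using linear_fun_linear_form[OF m] by blast
    have "eval_poly Q p = 0 \<and> eval_poly Q1 p = 0 \<and> eval_poly Q2 p = 0"
      if "eval_poly l' p = 0 \<and> eval_poly m' p = 0" for p
      using van that assms(4) by (simp add: a(2) b(2) l'(2) m'(2))
    thus ?thesis using l'(1) m'(1) by blast
  qed
qed

end
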